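(* For integers $0\le m<n$, \[\mathcal{C}_{n,m}=\frac{n(2m+1)}{(n-m)(m+1)}\sum_{k=0}^{n-m-1}\mathcal{C}_{k+m,m}\,\mathcal{C}_{n-m-k-1,0}.\]
   Context: A path is a finite sequence of points of $\mathbb{Z}^2$ in which each step is $(1,0)$ or $(0,1)$. For integers $0\le m\le n$, $\mathcal{C}_{n,m}$ denotes the number of paths from $(0,-2m)$ to $(n-m,n-m)$ not crossing the line $y=x$, i.e. all of whose points $(p,q)$ satisfy $q\le p$. (So $\mathcal{C}_{n,0}$ is the classical Catalan number.) *)

theory Defs
  imports Complex_Main
begin

definition step :: "int \<times> int \<Rightarrow> int \<times> int \<Rightarrow> bool" where
  "step P Q \<longleftrightarrow> Q = (fst P + 1, snd P) \<or> Q = (fst P, snd P + 1)"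

(* A path is the list of the points it visits, so it has at least one point;
   the one-point path is allowed. *)
definition path :: "(int \<times> int) list \<Rightarrow> bool" where
  "path ps \<longleftrightarrow> ps \<noteq> [] \<and> successively step ps"

definition path_from_to :: "int \<times> int \<Rightarrow> int \<times> int \<Rightarrow> (int \<times> int) list \<Rightarrow> bool" where
  "path_from_to A B ps \<longleftrightarrow> path ps \<and> hd ps = A \<and> last ps = B"

definition not_crossing_diagonal :: "(int \<times> int) list \<Rightarrow> bool" where
  "not_crossing_diagonal ps \<longleftrightarrow> (\<forall>(p, q) \<in> set ps. q \<le> p)"

(* Meant for m \<le> n; the subtraction n - m takes place in int. *)
definition gen_catalan :: "nat \<Rightarrow> nat \<Rightarrow> nat" where
  "gen_catalan n m =
     card {ps. path_from_to (0, - 2 * int m) (int n - int m, int n - int m) ps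
               \<and> not_crossing_diagonal ps}"

end

theory Submission
  imports Defs
begin

text \<open>
  Let \<open>ballot h k\<close> count the paths with \<open>k\<close> east steps that start \<open>h\<close> units below the
  diagonal, never cross it and end on it, so that \<open>\<C>\<^sub>n\<^sub>,\<^sub>m = ballot (2m) (n - m)\<close>.
  Cutting a path that starts \<open>h + 1\<close> units below the diagonal at its first visit to the
  diagonal shows that the convolution of \<open>ballot h\<close> with the Catalan numbers \<open>ballot 0\<close> is
  \<open>ballot (h + 1)\<close>; formally this is an induction along the recurrence. The sum in the theorem
  is thus \<open>ballot (2m + 1) (n - m - 1)\<close>, and the closed form
  \<open>(h + k + 1) * ballot h k = (h + 1) * ((h + 2k) choose k)\<close> gives the stated factor.
\<close>

text \<open>The equations split by the first step: north lowers \<open>h\<close>, east raises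
  \<open>h\<close> and lowers \<open>k\<close>. North is barred at \<open>h = 0\<close>, and no east
  step is left at \<open>k = 0\<close>.\<close>

fun ballot :: "nat \<Rightarrow> nat \<Rightarrow> nat" where
  "ballot 0 0 = 1"
| "ballot (Suc h) 0 = ballot h 0"
| "ballot 0 (Suc k) = ballot 1 k"
| "ballot (Suc h) (Suc k) = ballot h (Suc k) + ballot (Suc (Suc h)) k"

lemma ballot_0_right [simp]: "ballot h 0 = 1"
  by (induction h) simp_all

lemma ballot_convolution: "(\<Sum>i\<le>N. ballot h i * ballot 0 (N - i)) = ballot (Suc h) N"
proof (induction h N rule: ballot.induct)
  case (3 N)
  then show ?case
    by (simp add: sum.atMost_Suc_shift del: sum.atMost_Suc)
next
  case (4 h N)
  have "(\<Sum>i\<le>Suc N. ballot (Suc h) i * ballot 0 (Suc N - i))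
      = ballot 0 (Suc N) + (\<Sum>i\<le>N. ballot h (Suc i) * ballot 0 (N - i))
        + (\<Sum>i\<le>N. ballot (Suc (Suc h)) i * ballot 0 (N - i))"
    by (simp add: sum.atMost_Suc_shift sum.distrib algebra_simps del: sum.atMost_Suc)
  \<comment> \<open>Since \<open>ballot h 0 = 1\<close>, the isolated
    \<open>ballot 0 (Suc N)\<close> is the missing summand \<open>i = 0\<close>.\<close>
  also have "\<dots> = (\<Sum>i\<le>Suc N. ballot h i * ballot 0 (Suc N - i))
        + (\<Sum>i\<le>N. ballot (Suc (Suc h)) i * ballot 0 (N - i))"
    by (simp add: sum.atMost_Suc_shift del: sum.atMost_Suc)
  finally show ?case
    using 4 by simp
qed simp_all

text \<open>Reflection principle, stated additively to avoid truncated subtraction: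
  \<open>(h + 2 * k + 2) choose k\<close> counts the crossing paths. The induction rests on Pascal's
  rule.\<close>

lemma ballot_reflection: "ballot h (Suc k) + ((h + 2 * k + 2) choose k) = (h + 2 * k + 2) choose Suc k"
proof (induction k arbitrary: h)
  case 0
  show ?case
    by (induction h) simp_all
next
  case IH: (Suc k)
  show ?case
  proof (induction h)
    case 0
    \<comment> \<open>Given the induction hypothesis, Pascal's rule leaves only the equality of the
      two middle entries of an odd row.\<close>
    have "(2 * k + 3) choose Suc (Suc k) = (2 * k + 3) choose Suc k"
      using binomial_symmetric[of "Suc k" "2 * k + 3"] by simp
    then show ?case
      using IH[of 1] by (simp add: eval_nat_numeral)
  next
    case (Suc h)
    then show ?case
      using IH[of "Suc (Suc h)"]
      by (simp add: eval_nat_numeral)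
  qed
qed

lemma ballot_closed_form:
  "(h + k + 1) * ballot h k = (h + 1) * ((h + 2 * k) choose k)"
proof (cases k)
  case (Suc j)
  define a b where "a = (h + 2 * k) choose j" and "b = (h + 2 * k) choose k"
  \<comment> \<open>The ratio of neighbouring binomials turns \<open>b - a\<close>, multiplied by
    \<open>h + k + 1\<close>, into \<open>(h + 1) * b\<close>.\<close>
  have absorb: "k * b = (h + k + 1) * a"
    using binomial_absorb_comp[of "h + 2 * k" j] binomial_absorption[of j "h + 2 * k"]
    unfolding a_def b_def Suc by (simp add: algebra_simps)
  have "ballot h k + a = b"
    using ballot_reflection[of h j] by (simp add: a_def b_def Suc)
  then have "(h + k + 1) * ballot h k + k * b = (h + k + 1) * b"
    unfolding absorb by (metis distrib_left)
  then show ?thesis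
    unfolding b_def by (simp add: algebra_simps)
qed simp

text \<open>Source of the factor in the theorem, with \<open>h = 2 * m\<close> and
  \<open>k = n - m - 1\<close>. Both closed forms carry \<open>h + k + 2\<close>, which
  cancels.\<close>

lemma ballot_ratio:
  "Suc k * (h + 2) * ballot h (Suc k) = (h + 2 * k + 2) * (h + 1) * ballot (Suc h) k"
proof -
  have absorb: "Suc k * ((h + 2 * k + 2) choose Suc k) = (h + 2 * k + 2) * ((h + 2 * k + 1) choose k)"
    using binomial_absorption[of k "h + 2 * k + 2"] by simp
  have left: "(h + k + 2) * ballot h (Suc k) = (h + 1) * ((h + 2 * k + 2) choose Suc k)"
    using ballot_closed_form[of h "Suc k"] by simp
  have right: "(h + k + 2) * ballot (Suc h) k = (h + 2) * ((h + 2 * k + 1) choose k)"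
    using ballot_closed_form[of "Suc h" k] by simp
  have "(h + k + 2) * (Suc k * (h + 2) * ballot h (Suc k))
      = Suc k * (h + 2) * ((h + k + 2) * ballot h (Suc k))"
    by (simp only: mult_ac)
  also have "\<dots> = (h + 2) * (h + 1) * (Suc k * ((h + 2 * k + 2) choose Suc k))"
    unfolding left by (simp only: mult_ac)
  also have "\<dots> = (h + 2 * k + 2) * (h + 1) * ((h + k + 2) * ballot (Suc h) k)"
    unfolding absorb right by (simp only: mult_ac)
  also have "\<dots> = (h + k + 2) * ((h + 2 * k + 2) * (h + 1) * ballot (Suc h) k)"
    by (simp only: mult_ac)
  finally show ?thesis
    by (simp only: mult_cancel1) simp
qed

definition paths_below :: "int \<times> int \<Rightarrow> int \<times> int \<Rightarrow> (int \<times> int) list set" where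
  "paths_below A B = {ps. path_from_to A B ps \<and> not_crossing_diagonal ps}"

lemma paths_below_above_diagonal: "p < q \<Longrightarrow> paths_below (p, q) B = {}"
  by (force simp: paths_below_def path_from_to_def path_def not_crossing_diagonal_def
      dest: hd_in_set)

lemma fst_le_of_path: "path_from_to A B ps \<Longrightarrow> fst A \<le> fst B"
proof (induction ps arbitrary: A)
  case (Cons P ps)
  then show ?case
    by (cases ps) (fastforce simp: path_from_to_def path_def step_def)+
qed (simp add: path_from_to_def path_def)

lemma paths_below_right_of_end: "fst B < fst A \<Longrightarrow> paths_below A B = {}"
  using fst_le_of_path by (fastforce simp: paths_below_def)

lemma paths_below_step:
  assumes "q \<le> p"
  shows "paths_below (p, q) B = (if (p, q) = B then {[B]} else {}) \<union>
    (#) (p, q) ` (paths_below (p + 1, q) B \<union> paths_below (p, q + 1) B)" (is "_ = ?R")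
proof (intro set_eqI)
  fix ps
  show "ps \<in> paths_below (p, q) B \<longleftrightarrow> ps \<in> ?R"
  proof (cases ps)
    case Nil
    then show ?thesis
      by (auto simp: paths_below_def path_from_to_def path_def)
  next
    case (Cons P qs)
    then show ?thesis
      using assms
      by (cases qs)
        (auto simp: paths_below_def path_from_to_def path_def step_def not_crossing_diagonal_def)
  qed
qed

lemma disjoint_paths_below:
  "A \<noteq> A' \<Longrightarrow> paths_below A B \<inter> paths_below A' B = {}"
  by (auto simp: paths_below_def path_from_to_def)

text \<open>Splitting by the first step reproduces the recurrence of \<open>ballot\<close>.
  Finiteness is carried along because adding the cardinalities of the two branches needs it.\<close>

lemma card_paths_below:
  "finite (paths_below (c - int k, c - int k - int h) (c, c)) \<and>
   card (paths_below (c - int k, c - int k - int h) (c, c)) = ballot h k"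
proof (induction h k rule: ballot.induct)
  case 1
  have "paths_below (c, c) (c, c) = {[(c, c)]}"
    using paths_below_step[of c c "(c, c)"]
    by (simp add: paths_below_above_diagonal paths_below_right_of_end)
  then show ?case
    by simp
next
  case (2 h)
  \<comment> \<open>The start already lies in the last column, so an east step would
    overshoot.\<close>
  have "paths_below (c, c - 1 - int h) (c, c)
      = (#) (c, c - 1 - int h) ` paths_below (c, c - int h) (c, c)"
    using paths_below_step[of "c - 1 - int h" c "(c, c)"]
    by (simp add: paths_below_right_of_end)
  then show ?case
    using 2 by (simp add: card_image diff_diff_eq)
next
  case (3 k)
  define p where "p = c - int (Suc k)"
  have "paths_below (p, p) (c, c) = (#) (p, p) ` paths_below (p + 1, p) (c, c)"
    using paths_below_step[of p p "(c, c)"]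
    by (simp add: paths_below_above_diagonal p_def)
  moreover have "p + 1 = c - int k" "p - int 0 = p" "c - int k - int 1 = p"
    by (simp_all add: p_def)
  ultimately show ?case
    using 3 unfolding p_def[symmetric] by (simp add: card_image)
next
  case (4 h k)
  define p where "p = c - int (Suc k)"
  define q where "q = p - int (Suc h)"
  have ends: "p + 1 = c - int k" "q + 1 = p - int h" "c - int k - int (Suc (Suc h)) = q"
    by (simp_all add: p_def q_def)
  have "paths_below (p, q) (c, c)
      = (#) (p, q) ` (paths_below (c - int k, q) (c, c) \<union> paths_below (p, p - int h) (c, c))"
    using paths_below_step[of q p "(c, c)"] unfolding ends by (simp add: p_def q_def)
  moreover have "paths_below (c - int k, q) (c, c) \<inter> paths_below (p, p - int h) (c, c) = {}"
    using ends(1) by (intro disjoint_paths_below) simp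
  ultimately show ?case
    using 4 unfolding p_def[symmetric] q_def[symmetric] ends(3)
    by (simp add: card_image card_Un_disjoint)
qed

lemma gen_catalan_eq_ballot:
  assumes "m \<le> n"
  shows "gen_catalan n m = ballot (2 * m) (n - m)"
  using card_paths_below[of "int n - int m" "n - m" "2 * m"] assms
  by (simp add: gen_catalan_def paths_below_def of_nat_diff)

theorem theorem5p1:
  fixes m n :: nat
  assumes "m < n"
  shows "real (gen_catalan n m) =
    (real n * (2 * real m + 1)) / ((real n - real m) * (real m + 1)) *
    (\<Sum>k = 0..n - m - 1. real (gen_catalan (k + m) m) * real (gen_catalan (n - m - k - 1) 0))"
proof -
  obtain N where n: "n = Suc (m + N)"
    using assms less_imp_Suc_add by blast
  have "(\<Sum>k = 0..n - m - 1. real (gen_catalan (k + m) m) * real (gen_catalan (n - m - k - 1) 0))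
      = real (\<Sum>k\<le>N. ballot (2 * m) k * ballot 0 (N - k))"
    by (simp add: n gen_catalan_eq_ballot atLeast0AtMost)
  also have "\<dots> = real (ballot (Suc (2 * m)) N)"
    by (simp only: ballot_convolution)
  finally have sum_eq: "(\<Sum>k = 0..n - m - 1. real (gen_catalan (k + m) m)
      * real (gen_catalan (n - m - k - 1) 0)) = real (ballot (Suc (2 * m)) N)" .
  \<comment> \<open>The common factor 2 comes from \<open>h + 2 = 2 * (m + 1)\<close> and
    \<open>h + 2 * N + 2 = 2 * n\<close> at \<open>h = 2 * m\<close>.\<close>
  have "2 * (Suc N * (m + 1) * ballot (2 * m) (Suc N))
      = 2 * (n * (2 * m + 1) * ballot (Suc (2 * m)) N)"
    using ballot_ratio[of N "2 * m"] by (simp add: n algebra_simps)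
  then have "real (Suc N * (m + 1) * ballot (2 * m) (Suc N))
      = real (n * (2 * m + 1) * ballot (Suc (2 * m)) N)"
    by (simp only: mult_cancel1) simp
  then have "real (Suc N) * (real m + 1) * real (ballot (2 * m) (Suc N))
      = real n * (2 * real m + 1) * real (ballot (Suc (2 * m)) N)"
    by (simp only: of_nat_mult of_nat_add of_nat_1 of_nat_numeral)
  moreover have "gen_catalan n m = ballot (2 * m) (Suc N)" "real n - real m = real (Suc N)"
    using assms by (simp_all add: n gen_catalan_eq_ballot)
  moreover have "real (Suc N) * (real m + 1) \<noteq> 0"
    by (simp add: add_eq_0_iff)
  ultimately show ?thesis
    unfolding sum_eq by (simp add: eq_divide_eq mult_ac)
qed

end
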